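(* Let $X$ be a real smooth and 2-uniformly convex Banach space. Then there exists $\mu\ge 1$ such that $$\frac{1}{2\mu}\|x-y\|^2\le\langle x-y,Jx-Jy\rangle\qquad\text{for all }x,y\in X.$$
   Context: $J:X\to X^*$ is the normalized duality mapping, $\langle x,Jx\rangle=\|x\|^2=\|Jx\|^2$ (single-valued since $X$ is smooth). $X$ is 2-uniformly convex if there is $C>0$ with $\delta_X(\varepsilon)\ge C\varepsilon^2$ for all $\varepsilon>0$, where $\delta_X(\varepsilon)=\inf\{1-\frac{\|x+y\|}{2}:\|x\|=\|y\|=1,\ \|x-y\|=\varepsilon\}$ is the modulus of convexity. *)

theory Defs
  imports "HOL-Analysis.Analysis"
begin

(* Gateaux differentiability of the norm on the unit sphere. *)
definition smooth_space :: "'a::real_normed_vector itself \<Rightarrow> bool" where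
  "smooth_space _ \<longleftrightarrow>
     (\<forall>x y :: 'a. norm x = 1 \<longrightarrow> norm y = 1 \<longrightarrow>
        (\<exists>l :: real. ((\<lambda>t :: real. (norm (x + t *\<^sub>R y) - norm x) / t) \<longlongrightarrow> l) (at 0)))"

(* The infimum is taken in the extended reals, so that it is \<infinity> over the empty set:
   no unit vectors are at distance \<epsilon> when \<epsilon> > 2. *)
definition modulus_convexity :: "'a::real_normed_vector itself \<Rightarrow> real \<Rightarrow> ereal" where
  "modulus_convexity _ \<epsilon> =
     Inf {ereal (1 - norm (x + y) / 2) | x y :: 'a.
            norm x = 1 \<and> norm y = 1 \<and> norm (x - y) = \<epsilon>}"

definition two_uniformly_convex :: "'a::real_normed_vector itself \<Rightarrow> bool" where
  "two_uniformly_convex X \<longleftrightarrow>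
     (\<exists>C :: real. C > 0 \<and> (\<forall>\<epsilon> > 0. modulus_convexity X \<epsilon> \<ge> ereal (C * \<epsilon>\<^sup>2)))"

(* Meaningful on smooth spaces, where exactly one functional satisfies the condition. *)
definition duality_map :: "'a::real_normed_vector \<Rightarrow> ('a \<Rightarrow>\<^sub>L real)" where
  "duality_map x =
     (THE f. blinfun_apply f x = (norm x)\<^sup>2 \<and> (norm x)\<^sup>2 = (norm f)\<^sup>2)"

end

theory Submission
  imports Defs
begin

text \<open>
  In a smooth space the Gateaux derivative of the norm at a unit vector is sublinear and odd, hence
  linear, and it is the only norming functional there; so the duality mapping is well defined without
  Hahn--Banach.  Write \<open>x = a u\<close> and \<open>y = b v\<close> with \<open>u\<close>, \<open>v\<close> unit vectors and \<open>a, b \<ge> 0\<close>.  Then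
  \<open>\<langle>u + v, Jx\<rangle> \<le> a \<parallel>u + v\<parallel> \<le> a (2 - 2 C \<parallel>u - v\<parallel>\<^sup>2)\<close>, and likewise for \<open>Jy\<close>, so that
  \<open>\<langle>x - y, Jx - Jy\<rangle> \<ge> (a - b)\<^sup>2 + 4 C a b \<parallel>u - v\<parallel>\<^sup>2\<close>, while
  \<open>\<parallel>x - y\<parallel>\<^sup>2 \<le> (\<bar>a - b\<bar> + min a b \<parallel>u - v\<parallel>)\<^sup>2 \<le> 2 (a - b)\<^sup>2 + 2 a b \<parallel>u - v\<parallel>\<^sup>2\<close>.
\<close>

text \<open>Smoothness only speaks of unit directions. A nonzero direction \<open>y\<close> is
  reduced to \<open>w\<close> of norm 1 by the substitution of \<open>c * t\<close> for
  \<open>t\<close>, which multiplies the limit by \<open>c = norm y\<close>.\<close>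

lemma smooth_space_norm_derivative:
  fixes u y :: "'a::real_normed_vector"
  assumes "smooth_space TYPE('a)" and "norm u = 1"
  shows "\<exists>l. ((\<lambda>t. (norm (u + t *\<^sub>R y) - norm u) / t) \<longlongrightarrow> l) (at 0)"
proof (cases "y = 0")
  case True
  then show ?thesis by (auto intro!: exI[of _ 0])
next
  case False
  define c where "c = norm y"
  define w where "w = y /\<^sub>R c"
  have c: "c > 0" using False by (simp add: c_def)
  have "norm w = 1" using False by (simp add: w_def c_def)
  then obtain l where l: "((\<lambda>t. (norm (u + t *\<^sub>R w) - norm u) / t) \<longlongrightarrow> l) (at 0)"
    using assms unfolding smooth_space_def by blast
  have "filterlim (\<lambda>t. c * t) (at 0) (at (0::real))"
    unfolding filterlim_at using c
    by (auto intro!: tendsto_eq_intros simp: eventually_at_filter)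
  from filterlim_compose[OF l this]
  have "((\<lambda>t. c * ((norm (u + (c * t) *\<^sub>R w) - norm u) / (c * t))) \<longlongrightarrow> c * l) (at 0)"
    by (intro tendsto_mult_left)
  moreover have "(c * t) *\<^sub>R w = t *\<^sub>R y" for t
    using c by (simp add: w_def field_simps)
  then have "(\<lambda>t. c * ((norm (u + (c * t) *\<^sub>R w) - norm u) / (c * t)))
      = (\<lambda>t. (norm (u + t *\<^sub>R y) - norm u) / t)"
    using c by (simp add: fun_eq_iff)
  ultimately show ?thesis by auto
qed

text \<open>Since \<open>f\<close> lies below the norm and agrees with it at \<open>u\<close>, every
  difference quotient with \<open>t > 0\<close> is at least \<open>f y\<close>. Used at
  \<open>y\<close> and \<open>- y\<close>, this forces uniqueness of the norming functional.\<close>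

lemma norming_functional_le_derivative:
  fixes f :: "'a::real_normed_vector \<Rightarrow>\<^sub>L real"
  assumes "((\<lambda>t. (norm (u + t *\<^sub>R y) - norm u) / t) \<longlongrightarrow> l) (at 0)"
    and "f u = norm u" and "norm f \<le> 1"
  shows "f y \<le> l"
proof (rule tendsto_lowerbound)
  show "((\<lambda>t. (norm (u + t *\<^sub>R y) - norm u) / t) \<longlongrightarrow> l) (at_right 0)"
    using assms(1) by (rule filterlim_mono) (auto simp: at_within_le_at)
  have "f y \<le> (norm (u + t *\<^sub>R y) - norm u) / t" if "t > 0" for t
  proof -
    have "f (u + t *\<^sub>R y) \<le> norm f * norm (u + t *\<^sub>R y)"
      using norm_blinfun[of f "u + t *\<^sub>R y"] by simp
    also have "\<dots> \<le> norm (u + t *\<^sub>R y)"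
      using assms(3) by (simp add: mult_left_le_one_le)
    finally show ?thesis
      using that assms(2) by (simp add: blinfun.add_right blinfun.scaleR_right field_simps)
  qed
  then show "\<forall>\<^sub>F t in at_right 0. f y \<le> (norm (u + t *\<^sub>R y) - norm u) / t"
    by (auto simp: eventually_at_filter)
qed simp

text \<open>The directional derivative \<open>p\<close> of the norm at \<open>u\<close> is itself
  the norming functional, and any other one is dominated by it.\<close>

lemma smooth_space_ex1_norming_functional:
  fixes u :: "'a::real_normed_vector"
  assumes "smooth_space TYPE('a)" and u: "norm u = 1"
  shows "\<exists>!f :: 'a \<Rightarrow>\<^sub>L real. blinfun_apply f u = 1 \<and> norm f = 1"
proof -
  define q where "q y t = (norm (u + t *\<^sub>R y) - norm u) / t" for y t
  obtain p where p: "\<And>y. (q y \<longlongrightarrow> p y) (at 0)"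
    using smooth_space_norm_derivative[OF assms] unfolding q_def by metis
  have pr: "(q y \<longlongrightarrow> p y) (at_right 0)" for y
    using p by (rule filterlim_mono) (auto simp: at_within_le_at)
  \<comment> \<open>The limit at 0 is two-sided, so the substitution of \<open>c * t\<close> for
    \<open>t\<close> also covers negative \<open>c\<close>; this is the source of oddness. For
    \<open>c = 0\<close> the substitution would leave the punctured neighbourhood.\<close>
  have scale: "p (c *\<^sub>R y) = c * p y" for c y
  proof (cases "c = 0")
    case True
    have "q 0 = (\<lambda>t. 0)" by (auto simp: q_def)
    with p[of 0] True show ?thesis
      using LIM_unique[of "\<lambda>t::real. 0::real" "p 0" 0 0] by simp
  next
    case False
    have "filterlim (\<lambda>t. c * t) (at 0) (at (0::real))"
      unfolding filterlim_at using False
      by (auto intro!: tendsto_eq_intros simp: eventually_at_filter)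
    from filterlim_compose[OF p this]
    have "((\<lambda>t. c * q y (c * t)) \<longlongrightarrow> c * p y) (at 0)"
      by (intro tendsto_mult_left)
    moreover have "(\<lambda>t. c * q y (c * t)) = q (c *\<^sub>R y)"
      using False by (auto simp: q_def fun_eq_iff mult.commute)
    ultimately show ?thesis using p[of "c *\<^sub>R y"] LIM_unique by metis
  qed
  \<comment> \<open>The point \<open>u + t *\<^sub>R (y + z)\<close> is the midpoint of
    \<open>u + (2 * t) *\<^sub>R y\<close> and \<open>u + (2 * t) *\<^sub>R z\<close>, so the
    triangle inequality compares the quotient at \<open>t\<close> with those at
    \<open>2 * t\<close>. The limit is taken from the right so that dividing by \<open>t\<close>
    keeps the inequality.\<close>
  have subadd: "p (y + z) \<le> p y + p z" for y z
  proof (rule tendsto_le)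
    have *: "filterlim (\<lambda>t. 2 * t) (at_right 0) (at_right (0::real))"
      unfolding filterlim_at
      by (auto intro!: tendsto_eq_intros simp: eventually_at_filter)
    show "((\<lambda>t. q y (2 * t) + q z (2 * t)) \<longlongrightarrow> p y + p z) (at_right 0)"
      by (intro tendsto_add filterlim_compose[OF pr *])
    show "(q (y + z) \<longlongrightarrow> p (y + z)) (at_right 0)" by (rule pr)
    have "q (y + z) t \<le> q y (2 * t) + q z (2 * t)" if "t > 0" for t
    proof -
      have "2 *\<^sub>R (u + t *\<^sub>R (y + z)) = (u + (2 * t) *\<^sub>R y) + (u + (2 * t) *\<^sub>R z)"
        by (simp add: algebra_simps scaleR_2)
      then have "2 * norm (u + t *\<^sub>R (y + z)) \<le> norm (u + (2 * t) *\<^sub>R y) + norm (u + (2 * t) *\<^sub>R z)"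
        by (metis norm_scaleR abs_numeral norm_triangle_ineq)
      then have "(2 * norm (u + t *\<^sub>R (y + z)) - 2 * norm u) / (2 * t)
          \<le> (norm (u + (2 * t) *\<^sub>R y) + norm (u + (2 * t) *\<^sub>R z) - 2 * norm u) / (2 * t)"
        using that by (intro divide_right_mono) auto
      then show ?thesis by (simp add: q_def add_divide_distrib diff_divide_distrib)
    qed
    then show "\<forall>\<^sub>F t in at_right 0. q (y + z) t \<le> q y (2 * t) + q z (2 * t)"
      by (auto simp: eventually_at_filter)
  qed simp
  have odd: "p (- y) = - p y" for y using scale[of "-1" y] by simp
  \<comment> \<open>Subadditivity at \<open>- y\<close> and \<open>- z\<close> becomes, by oddness,
    the reverse inequality.\<close>
  have add: "p (y + z) = p y + p z" for y z
    using subadd[of y z] subadd[of "-y" "-z"] odd[of "y + z"] by (simp add: odd)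
  have le: "p y \<le> norm y" for y
  proof (rule tendsto_upperbound[OF pr])
    have "q y t \<le> norm y" if "t > 0" for t
      using that norm_triangle_ineq[of u "t *\<^sub>R y"] by (simp add: q_def field_simps)
    then show "\<forall>\<^sub>F t in at_right 0. q y t \<le> norm y"
      by (auto simp: eventually_at_filter)
  qed simp
  have bound: "norm (p y) \<le> norm y * 1" for y
    using le[of y] le[of "- y"] by (simp add: odd abs_le_iff)
  have bl: "bounded_linear p"
    by (rule bounded_linear_intro[OF add _ bound]) (simp add: scale)
  have pu: "p u = 1"
  proof -
    have "\<forall>\<^sub>F t in at_right 0. q u t = 1"
    proof -
      have "q u t = 1" if "t > 0" for t
      proof -
        have "u + t *\<^sub>R u = (1 + t) *\<^sub>R u" by (simp add: algebra_simps)
        then have "norm (u + t *\<^sub>R u) = 1 + t"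
          using that u by (metis abs_of_pos add_pos_pos mult.right_neutral norm_scaleR zero_less_one)
        then show ?thesis using that u by (simp add: q_def)
      qed
      then show ?thesis by (auto simp: eventually_at_filter)
    qed
    then have "(q u \<longlongrightarrow> 1) (at_right 0)" by (rule tendsto_eventually)
    then show ?thesis using pr[of u] tendsto_unique[of "at_right (0::real)"] by force
  qed
  define P where "P = Blinfun p"
  have P: "blinfun_apply P = p" unfolding P_def by (rule bounded_linear_Blinfun_apply[OF bl])
  have "norm P = 1"
  proof (rule antisym)
    show "norm P \<le> 1" by (rule norm_blinfun_bound) (use bound in \<open>auto simp: P mult.commute\<close>)
    show "1 \<le> norm P" using norm_blinfun[of P u] by (simp add: P pu u)
  qed
  moreover have "f = P" if f: "f u = 1" "norm f = 1" for f :: "'a \<Rightarrow>\<^sub>L real"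
  proof (rule blinfun_eqI)
    fix y
    have "f z \<le> p z" for z
      by (rule norming_functional_le_derivative[of u z]) (use p[of z] f u in \<open>auto simp: q_def[abs_def]\<close>)
    from this[of y] this[of "- y"] show "f y = P y"
      by (simp add: P odd blinfun.minus_right)
  qed
  ultimately show ?thesis using P pu by auto
qed

text \<open>The definite description in \<open>duality_map\<close> says something only once unique
  existence is known. For nonzero \<open>x\<close> this is inherited by scaling from the norming
  functional at \<open>x / norm x\<close>; at 0 only the zero functional has norm 0.\<close>

lemma smooth_space_duality_map:
  fixes x :: "'a::real_normed_vector"
  assumes "smooth_space TYPE('a)"
  shows "duality_map x x = (norm x)\<^sup>2" and "norm (duality_map x) = norm x"
proof -
  let ?Q = "\<lambda>f :: 'a \<Rightarrow>\<^sub>L real. blinfun_apply f x = (norm x)\<^sup>2 \<and> (norm x)\<^sup>2 = (norm f)\<^sup>2"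
  have "\<exists>!f. ?Q f"
  proof (cases "x = 0")
    case True
    then show ?thesis by (auto intro!: ex1I[of _ 0])
  next
    case False
    define a where "a = norm x"
    define u where "u = x /\<^sub>R a"
    have a: "a > 0" using False by (simp add: a_def)
    have x: "x = a *\<^sub>R u" using a by (simp add: u_def)
    have "norm u = 1" using False by (simp add: u_def a_def)
    from smooth_space_ex1_norming_functional[OF assms this]
    obtain f :: "'a \<Rightarrow>\<^sub>L real" where f: "f u = 1" "norm f = 1"
      and uniq: "\<And>g :: 'a \<Rightarrow>\<^sub>L real. blinfun_apply g u = 1 \<Longrightarrow> norm g = 1 \<Longrightarrow> g = f"
      by blast
    show ?thesis
    proof (rule ex1I[of _ "a *\<^sub>R f"])
      show "?Q (a *\<^sub>R f)"
        using a f unfolding a_def[symmetric]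
        by (simp add: x blinfun.scaleR_right blinfun.scaleR_left power2_eq_square)
    next
      fix g :: "'a \<Rightarrow>\<^sub>L real" assume g: "?Q g"
      then have "norm g = a" using a by (simp add: a_def power2_eq_iff_nonneg)
      moreover have "g u = a"
        using conjunct1[OF g] a unfolding a_def[symmetric] by (simp add: u_def blinfun.scaleR_right power2_eq_square)
      ultimately have "g /\<^sub>R a = f"
        using a by (intro uniq) (auto simp: blinfun.scaleR_left)
      then show "g = a *\<^sub>R f" using a by auto
    qed
  qed
  from theI'[OF this] have "?Q (duality_map x)" unfolding duality_map_def .
  then show "duality_map x x = (norm x)\<^sup>2" and "norm (duality_map x) = norm x"
    by (auto simp: power2_eq_iff_nonneg)
qed

text \<open>The pair \<open>u\<close>, \<open>v\<close> competes in the infimum at \<epsilon>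
  \<open>= norm (u - v)\<close>. The case \<open>u = v\<close>, where this distance is 0, is the
  triangle inequality.\<close>

lemma two_uniformly_convex_norm_add:
  assumes "two_uniformly_convex TYPE('a::real_normed_vector)"
  obtains C where "C > 0" and "\<And>u v :: 'a. norm u = 1 \<Longrightarrow> norm v = 1 \<Longrightarrow>
    norm (u + v) \<le> 2 - 2 * C * (norm (u - v))\<^sup>2"
proof -
  obtain C where C: "C > 0"
    and mod: "\<And>e. e > 0 \<Longrightarrow> ereal (C * e\<^sup>2) \<le> modulus_convexity TYPE('a) e"
    using assms unfolding two_uniformly_convex_def by blast
  have "norm (u + v) \<le> 2 - 2 * C * (norm (u - v))\<^sup>2" if uv: "norm u = 1" "norm v = 1" for u v :: 'a
  proof (cases "u = v")
    case True
    then show ?thesis using norm_triangle_ineq[of u v] uv by simp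
  next
    case False
    then have "ereal (C * (norm (u - v))\<^sup>2) \<le> modulus_convexity TYPE('a) (norm (u - v))"
      by (intro mod) simp
    also have "\<dots> \<le> ereal (1 - norm (u + v) / 2)"
      unfolding modulus_convexity_def by (rule Inf_lower) (use uv in blast)
    finally show ?thesis by simp
  qed
  with C show ?thesis by (rule that)
qed

lemma norm_scaleR_diff_le:
  fixes u v :: "'a::real_normed_vector"
  assumes "norm u = 1" "norm v = 1" and "a \<ge> 0" "b \<ge> 0"
  shows "(norm (a *\<^sub>R u - b *\<^sub>R v))\<^sup>2 \<le> 2 * (a - b)\<^sup>2 + 2 * (a * b * (norm (u - v))\<^sup>2)"
  using assms
proof (induction a b arbitrary: u v rule: linorder_wlog)
  case (le a b)
  let ?d = "norm (u - v)"
  \<comment> \<open>The smaller scalar is put on \<open>u - v\<close>, so that its square can later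
    be bounded by \<open>a * b\<close>.\<close>
  have "a *\<^sub>R u - b *\<^sub>R v = a *\<^sub>R (u - v) + (a - b) *\<^sub>R v" by (simp add: algebra_simps)
  then have "norm (a *\<^sub>R u - b *\<^sub>R v) \<le> a * ?d + \<bar>a - b\<bar>"
    using norm_triangle_ineq[of "a *\<^sub>R (u - v)" "(a - b) *\<^sub>R v"] le.prems by simp
  then have "(norm (a *\<^sub>R u - b *\<^sub>R v))\<^sup>2 \<le> (a * ?d + \<bar>a - b\<bar>)\<^sup>2"
    by (rule power_mono) simp
  also have "\<dots> \<le> 2 * (a - b)\<^sup>2 + 2 * (a * a * ?d\<^sup>2)"
    using sum_squares_bound[of "a * ?d" "\<bar>a - b\<bar>"]
    by (simp add: power2_sum power_mult_distrib power2_eq_square[of a])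
  also have "\<dots> \<le> 2 * (a - b)\<^sup>2 + 2 * (a * b * ?d\<^sup>2)"
    using le by (intro add_left_mono mult_left_mono mult_right_mono) auto
  finally show ?case .
next
  case (sym a b)
  from sym(1)[of v u] sym.prems show ?case
    by (simp add: norm_minus_commute power2_commute mult.commute)
qed

theorem theorem3p4:
  assumes "smooth_space TYPE('a::banach)"
    and "two_uniformly_convex TYPE('a)"
  shows "\<exists>\<mu> :: real. \<mu> \<ge> 1 \<and>
    (\<forall>x y :: 'a. 1 / (2 * \<mu>) * (norm (x - y))\<^sup>2
       \<le> blinfun_apply (duality_map x - duality_map y) (x - y))"
proof -
  obtain C where C: "C > 0" and conv: "\<And>u v :: 'a. norm u = 1 \<Longrightarrow> norm v = 1 \<Longrightarrow>
      norm (u + v) \<le> 2 - 2 * C * (norm (u - v))\<^sup>2"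
    using two_uniformly_convex_norm_add[OF assms(2)] by blast
  \<comment> \<open>Both \<mu> \<ge> 1 and \<open>4 * C *\<close> \<mu> \<ge> 1 are needed, to
    absorb the coefficients of \<open>(a - b)\<^sup>2\<close> and of
    \<open>a * b * d\<^sup>2\<close> respectively.\<close>
  define \<mu> where "\<mu> = max 1 (1 / (4 * C))"
  have \<mu>: "\<mu> \<ge> 1" by (simp add: \<mu>_def)
  have \<mu>C: "1 \<le> 4 * C * \<mu>"
    using C by (simp add: \<mu>_def max_def field_simps)
  note J = smooth_space_duality_map[OF assms(1)]
  have J0: "duality_map (0::'a) = 0" using J(2)[of 0] by simp
  have "1 / (2 * \<mu>) * (norm (x - y))\<^sup>2 \<le> (duality_map x - duality_map y) (x - y)" for x y :: 'a
  \<comment> \<open>If one vector vanishes it has no direction to normalize, but the pairing is then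
    exactly \<open>(norm (x - y))\<^sup>2\<close>.\<close>
  proof (cases "x = 0 \<or> y = 0")
    case True
    have "1 / (2 * \<mu>) * (norm (x - y))\<^sup>2 \<le> 1 * (norm (x - y))\<^sup>2"
      using \<mu> by (intro mult_right_mono) auto
    also have "\<dots> = (duality_map x - duality_map y) (x - y)"
      using True J(1) by (auto simp: J0 blinfun.minus_left blinfun.minus_right)
    finally show ?thesis .
  next
    case False
    define a u where "a = norm x" and "u = x /\<^sub>R a"
    define b v where "b = norm y" and "v = y /\<^sub>R b"
    define d where "d = norm (u - v)"
    have a: "a > 0" and b: "b > 0" using False by (auto simp: a_def b_def)
    have u: "norm u = 1" and v: "norm v = 1" using a b by (auto simp: u_def v_def a_def b_def)
    have x: "x = a *\<^sub>R u" and y: "y = b *\<^sub>R v" using a b by (auto simp: u_def v_def)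
    \<comment> \<open>With \<open>w'\<close> the direction of \<open>z\<close>, the functional
      \<open>duality_map z\<close> takes the value \<open>norm z\<close> at \<open>w'\<close>. The
      convexity bound on \<open>w + w'\<close> therefore limits its value at \<open>w\<close>. The
      roles are swapped to treat \<open>x\<close> and \<open>y\<close> alike.\<close>
    have J_le: "duality_map z w \<le> norm z * (1 - 2 * C * d\<^sup>2)"
      if "z = norm z *\<^sub>R w'" "z \<noteq> 0" "norm (w + w') \<le> 2 - 2 * C * d\<^sup>2" for z w w' :: 'a
    proof -
      have "norm z * duality_map z w' = norm z * norm z"
        using J(1)[of z] that(1) by (metis blinfun.scaleR_right power2_eq_square real_scaleR_def)
      then have "duality_map z w' = norm z" using that(2) by simp
      moreover have "duality_map z (w + w') \<le> norm z * norm (w + w')"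
        using norm_blinfun[of "duality_map z" "w + w'"] by (simp add: J(2))
      moreover have "norm z * norm (w + w') \<le> norm z * (2 - 2 * C * d\<^sup>2)"
        using that(3) by (intro mult_left_mono) auto
      ultimately show ?thesis by (simp add: blinfun.add_right algebra_simps)
    qed
    have Jx: "duality_map x v \<le> a * (1 - 2 * C * d\<^sup>2)"
      using J_le[OF x[unfolded a_def], of v] conv[OF v u] False by (simp add: a_def d_def norm_minus_commute[of v u])
    have Jy: "duality_map y u \<le> b * (1 - 2 * C * d\<^sup>2)"
      using J_le[OF y[unfolded b_def], of u] conv[OF u v] False by (simp add: b_def d_def)
    have "(norm (x - y))\<^sup>2 \<le> 2 * (a - b)\<^sup>2 + 2 * (a * b * d\<^sup>2)"
      using norm_scaleR_diff_le[OF u v] a b by (simp add: x y d_def)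
    also have "\<dots> \<le> 2 * (\<mu> * (a - b)\<^sup>2) + 2 * (4 * C * \<mu> * (a * b * d\<^sup>2))"
    proof -
      have "0 \<le> a * b * d\<^sup>2" using a b by simp
      from mult_right_mono[OF \<mu>C this] mult_right_mono[OF \<mu> zero_le_power2[of "a - b"]]
      show ?thesis by linarith
    qed
    also have "\<dots> = 2 * \<mu> * ((a - b)\<^sup>2 + 4 * C * a * b * d\<^sup>2)"
      by (simp add: algebra_simps)
    finally have "1 / (2 * \<mu>) * (norm (x - y))\<^sup>2 \<le> (a - b)\<^sup>2 + 4 * C * a * b * d\<^sup>2"
      using \<mu> by (simp add: field_simps)
    \<comment> \<open>The lower bound is split into the two cross terms of the expanded pairing,
      each ready for \<open>Jx\<close> or \<open>Jy\<close>.\<close>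
    also have "\<dots> = a\<^sup>2 + b\<^sup>2 - b * (a * (1 - 2 * C * d\<^sup>2)) - a * (b * (1 - 2 * C * d\<^sup>2))"
      by (simp add: algebra_simps power2_eq_square)
    also have "\<dots> \<le> a\<^sup>2 + b\<^sup>2 - b * duality_map x v - a * duality_map y u"
      using a b Jx Jy by (intro diff_mono mult_left_mono) auto
    also have "\<dots> = (duality_map x - duality_map y) (x - y)"
    proof -
      have "duality_map x y = b * duality_map x v" "duality_map y x = a * duality_map y u"
        by (metis x y blinfun.scaleR_right real_scaleR_def)+
      then show ?thesis using J(1)[of x] J(1)[of y]
        by (simp add: blinfun.diff_left blinfun.diff_right a_def b_def)
    qed
    finally show ?thesis .
  qed
  with \<mu> show ?thesis by blast
qed

end
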